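(* Let $\mathcal A$ be an algebraic noncommutative geometry with associated set $\mathcal M\subset\mathbb R^n$ and commutative limit algebra $\mathcal A^0=\mathcal A/\varepsilon\mathcal A$, regarded as an algebra of complex-valued functions on $\mathcal M$. If $\mathcal M$ is compact, then $\mathcal A^0$ is dense in the space $C(\mathcal M)$ of continuous complex-valued functions on $\mathcal M$ with the uniform norm $\|f\|=\sup_{x\in\mathcal M}|f(x)|$.
   Context: Algebraic noncommutative geometry (ANCG). Let $\mathcal F^0$ be the free associative noncommutative unital complex algebra on generators $x_1,\dots,x_n$. Let $\mathcal F$ be either the algebra of polynomials, or the algebra of formal power series, in a central variable $\varepsilon$ with coefficients in $\mathcal F^0$. An ANCG is a quotient algebra $q:\mathcal F\to\mathcal A$ by the two-sided ideal generated by elements $c_{ij}\in\mathcal F$ ($i,j=1,\dots,n$) and $b_s\in\mathcal F$ ($s=1,\dots,n-D$), for some $D\le n$, such that: (1) $\mathcal A$ is associative and noncommutative; (2) $c_{ij}=x_ix_j-x_jx_i-i\varepsilon c'_{ij}$ with $c'_{ij}\in\mathcal F$, and for at least one pair $(i,j)$ the image of $c'_{ij}$ in $\mathcal A^0:=\mathcal A/\varepsilon\mathcal A$ is nonzero (the quotient map is written $\pi:\mathcal A\to\mathcal A^0$); (3) the image $b^0_s\in\mathbb C[x_1,\dots,x_n]$ of $b_s$ under setting $\varepsilon=0$ and letting the generators commute is nonzero for each $s$; (4) there is a conjugation $\dagger:\mathcal A\to\mathcal A$, antilinear over $\mathbb C$, with $(uv)^\dagger=v^\dagger u^\dagger$,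 $u^{\dagger\dagger}=u$, $\varepsilon^\dagger=\varepsilon$, $x_i^\dagger=x_i$. Put $\mathcal M=\{\underline x\in\mathbb R^n: b^0_s(\underline x)=0,\ s=1,\dots,n-D\}$. The commutative algebra $\mathcal A^0$ is identified with the algebra of complex functions on $\mathcal M$ that are restrictions of complex polynomials in the coordinates $x_1,\dots,x_n$ of $\mathbb R^n$ (the $x_i$ being real functions). *)

theory Defs
  imports
    "HOL-Analysis.Analysis"
    "HOL-Algebra.QuotRing"
    "HOL-Library.Poly_Mapping"
begin

section \<open>The free algebra\<close>

text \<open>
  The free complex algebra on generators indexed by \<open>'n\<close> is the monoid algebra over
  \<open>\<complex>\<close> of the free monoid on \<open>'n\<close>.  The product of finitely supported maps
  in \<open>Poly_Mapping\<close> is convolution over \<open>+\<close>, so concatenation of words has to be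
  written additively; the wrapper type avoids a global instance for lists.
\<close>

datatype 'n nc_word = NC_Word (letters: "'n list")

instantiation nc_word :: (type) monoid_add
begin

definition zero_nc_word :: "'a nc_word" where
  "0 = NC_Word []"

definition plus_nc_word :: "'a nc_word \<Rightarrow> 'a nc_word \<Rightarrow> 'a nc_word" where
  "u + v = NC_Word (letters u @ letters v)"

instance
  by standard (simp_all add: zero_nc_word_def plus_nc_word_def)

end

type_synonym 'n free_algebra = "'n nc_word \<Rightarrow>\<^sub>0 complex"

text \<open>
  Formal power series over the free algebra; the central variable \<open>\<epsilon>\<close> is \<open>fps_X\<close>.
  Polynomials in \<open>\<epsilon>\<close> are the power series with finitely many nonzero coefficients
  (the type constructor \<open>poly\<close> has no product over noncommutative coefficients).
\<close>

type_synonym 'n eps_algebra = "'n free_algebra fps"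

definition eps :: "'n eps_algebra" where
  "eps = fps_X"

definition gen :: "'n \<Rightarrow> 'n eps_algebra" where
  "gen i = fps_const (Poly_Mapping.single (NC_Word [i]) 1)"

definition scal :: "complex \<Rightarrow> 'n eps_algebra" where
  "scal z = fps_const (Poly_Mapping.single 0 z)"

definition eps_polynomials :: "'n eps_algebra set" where
  "eps_polynomials = {f. finite {k. fps_nth f k \<noteq> 0}}"

definition eps_ring :: "'n eps_algebra set \<Rightarrow> 'n eps_algebra ring" where
  "eps_ring F = \<lparr>carrier = F, mult = (*), one = 1, zero = 0, add = (+)\<rparr>"


section \<open>The classical limit of an element\<close>

type_synonym 'n comm_poly = "('n \<Rightarrow>\<^sub>0 nat) \<Rightarrow>\<^sub>0 complex"

definition comm_var :: "'n \<Rightarrow> 'n comm_poly" where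
  "comm_var i = Poly_Mapping.single (Poly_Mapping.single i 1) 1"

definition comm_image :: "'n free_algebra \<Rightarrow> 'n comm_poly" where
  "comm_image p =
     (\<Sum>w\<in>Poly_Mapping.keys p.
        Poly_Mapping.single 0 (Poly_Mapping.lookup p w) * prod_list (map comm_var (letters w)))"

definition classical :: "'n eps_algebra \<Rightarrow> 'n comm_poly" where
  "classical f = comm_image (fps_nth f 0)"

definition comm_eval :: "'n::finite comm_poly \<Rightarrow> real ^ 'n \<Rightarrow> complex" where
  "comm_eval p x =
     (\<Sum>m\<in>Poly_Mapping.keys p.
        Poly_Mapping.lookup p m * (\<Prod>i\<in>UNIV. complex_of_real (x $ i) ^ Poly_Mapping.lookup m i))"


section \<open>The quotient algebras\<close>

text \<open>
  Here \<open>n = CARD('n)\<close>.  The elements \<open>b s\<close> are only used for \<open>1 \<le> s \<le> n - D\<close>.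
\<close>

definition ancg_ideal ::
  "'n::finite eps_algebra set \<Rightarrow> nat \<Rightarrow> ('n \<Rightarrow> 'n \<Rightarrow> 'n eps_algebra) \<Rightarrow> (nat \<Rightarrow> 'n eps_algebra)
    \<Rightarrow> 'n eps_algebra set" where
  "ancg_ideal F D c b =
     genideal (eps_ring F) ({c i j | i j. True} \<union> b ` {1..CARD('n) - D})"

definition ancg_algebra ::
  "'n::finite eps_algebra set \<Rightarrow> nat \<Rightarrow> ('n \<Rightarrow> 'n \<Rightarrow> 'n eps_algebra) \<Rightarrow> (nat \<Rightarrow> 'n eps_algebra)
    \<Rightarrow> 'n eps_algebra set ring" where
  "ancg_algebra F D c b = eps_ring F Quot ancg_ideal F D c b"

definition ancg_q ::
  "'n::finite eps_algebra set \<Rightarrow> nat \<Rightarrow> ('n \<Rightarrow> 'n \<Rightarrow> 'n eps_algebra) \<Rightarrow> (nat \<Rightarrow> 'n eps_algebra)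
    \<Rightarrow> 'n eps_algebra \<Rightarrow> 'n eps_algebra set" where
  "ancg_q F D c b f = ancg_ideal F D c b +>\<^bsub>eps_ring F\<^esub> f"

definition ancg_eps_multiples ::
  "'n::finite eps_algebra set \<Rightarrow> nat \<Rightarrow> ('n \<Rightarrow> 'n \<Rightarrow> 'n eps_algebra) \<Rightarrow> (nat \<Rightarrow> 'n eps_algebra)
    \<Rightarrow> 'n eps_algebra set set" where
  "ancg_eps_multiples F D c b =
     {ancg_q F D c b eps \<otimes>\<^bsub>ancg_algebra F D c b\<^esub> u | u. u \<in> carrier (ancg_algebra F D c b)}"

definition ancg_limit ::
  "'n::finite eps_algebra set \<Rightarrow> nat \<Rightarrow> ('n \<Rightarrow> 'n \<Rightarrow> 'n eps_algebra) \<Rightarrow> (nat \<Rightarrow> 'n eps_algebra)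
    \<Rightarrow> 'n eps_algebra set set ring" where
  "ancg_limit F D c b = ancg_algebra F D c b Quot ancg_eps_multiples F D c b"

definition ancg_pi ::
  "'n::finite eps_algebra set \<Rightarrow> nat \<Rightarrow> ('n \<Rightarrow> 'n \<Rightarrow> 'n eps_algebra) \<Rightarrow> (nat \<Rightarrow> 'n eps_algebra)
    \<Rightarrow> 'n eps_algebra set \<Rightarrow> 'n eps_algebra set set" where
  "ancg_pi F D c b u = ancg_eps_multiples F D c b +>\<^bsub>ancg_algebra F D c b\<^esub> u"


section \<open>Algebraic noncommutative geometries\<close>

definition ancg_conjugation ::
  "'n::finite eps_algebra set \<Rightarrow> nat \<Rightarrow> ('n \<Rightarrow> 'n \<Rightarrow> 'n eps_algebra) \<Rightarrow> (nat \<Rightarrow> 'n eps_algebra)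
    \<Rightarrow> ('n eps_algebra set \<Rightarrow> 'n eps_algebra set) \<Rightarrow> bool" where
  "ancg_conjugation F D c b dag \<longleftrightarrow>
     (let A = ancg_algebra F D c b; q = ancg_q F D c b in
       (\<forall>u\<in>carrier A. dag u \<in> carrier A) \<and>
       (\<forall>u\<in>carrier A. \<forall>v\<in>carrier A. dag (u \<oplus>\<^bsub>A\<^esub> v) = dag u \<oplus>\<^bsub>A\<^esub> dag v) \<and>
       (\<forall>z. \<forall>u\<in>carrier A. dag (q (scal z) \<otimes>\<^bsub>A\<^esub> u) = q (scal (cnj z)) \<otimes>\<^bsub>A\<^esub> dag u) \<and>
       (\<forall>u\<in>carrier A. \<forall>v\<in>carrier A. dag (u \<otimes>\<^bsub>A\<^esub> v) = dag v \<otimes>\<^bsub>A\<^esub> dag u) \<and>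
       (\<forall>u\<in>carrier A. dag (dag u) = u) \<and>
       dag (q eps) = q eps \<and>
       (\<forall>i. dag (q (gen i)) = q (gen i)))"

text \<open>Associativity of the quotient is automatic; see \<open>ring_algebra\<close> below.\<close>

locale ancg =
  fixes F :: "'n::finite eps_algebra set"
    and D :: nat
    and c :: "'n \<Rightarrow> 'n \<Rightarrow> 'n eps_algebra"
    and b :: "nat \<Rightarrow> 'n eps_algebra"
  assumes poly_or_series: "F = eps_polynomials \<or> F = UNIV"
    and D_le: "D \<le> CARD('n)"
    and b_in: "\<And>s. s \<in> {1..CARD('n) - D} \<Longrightarrow> b s \<in> F"
    and noncommutative:
      "\<exists>u\<in>carrier (ancg_algebra F D c b). \<exists>v\<in>carrier (ancg_algebra F D c b).
         u \<otimes>\<^bsub>ancg_algebra F D c b\<^esub> v \<noteq> v \<otimes>\<^bsub>ancg_algebra F D c b\<^esub> u"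
    and commutators:
      "\<exists>c'. (\<forall>i j. c' i j \<in> F \<and>
                    c i j = gen i * gen j - gen j * gen i - scal \<i> * eps * c' i j) \<and>
            (\<exists>i j. ancg_pi F D c b (ancg_q F D c b (c' i j)) \<noteq> \<zero>\<^bsub>ancg_limit F D c b\<^esub>)"
    and classical_nonzero: "\<And>s. s \<in> {1..CARD('n) - D} \<Longrightarrow> classical (b s) \<noteq> 0"
    and conjugation: "\<exists>dag. ancg_conjugation F D c b dag"

definition ancg_set :: "nat \<Rightarrow> (nat \<Rightarrow> 'n::finite eps_algebra) \<Rightarrow> (real ^ 'n) set" where
  "ancg_set D b = {x. \<forall>s\<in>{1..CARD('n) - D}. comm_eval (classical (b s)) x = 0}"

text \<open>
  The metric of \<open>cfunspace\<close> is the uniform distance (lemma \<open>mdist_complex_functions\<close>);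
  on a compact \<open>M\<close> its carrier is the
  set of all continuous functions on \<open>M\<close> (extended by \<open>undefined\<close> outside \<open>M\<close>).
\<close>

definition complex_functions :: "(real ^ 'n::finite) set \<Rightarrow> (real ^ 'n \<Rightarrow> complex) metric" where
  "complex_functions M = cfunspace (top_of_set M) euclidean_metric"

lemma mspace_complex_functions:
  assumes "compact M"
  shows "mspace (complex_functions M) = {f \<in> extensional M. continuous_on M f}"
proof -
  have "Metric_space.mbounded UNIV dist (f ` M)" if "continuous_on M f" for f :: "_ \<Rightarrow> complex"
    using compact_imp_bounded[OF compact_continuous_image[OF that assms]] by simp
  then show ?thesis
    by (auto simp: complex_functions_def)
qed

lemma mdist_complex_functions:
  assumes "f \<in> mspace (complex_functions M)" "g \<in> mspace (complex_functions M)" "M \<noteq> {}"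
  shows "mdist (complex_functions M) f g = (SUP x\<in>M. norm (f x - g x))"
  using assms
  by (simp add: complex_functions_def mdist_cfunspace_eq_mdist_funspace Met_TC.fdist_def
      Met_TC.fspace_def dist_norm)

text \<open>
  The function on \<open>ancg_set D b\<close> given by an element \<open>a\<close> of the commutative limit: evaluate the
  classical limit of any representative of \<open>a\<close>.  Independence of the representative, and the
  fact that exactly the restrictions of complex polynomials arise, are shown in
  \<open>ancg_fun_pi_q\<close> and \<open>ancg_fun_range\<close>.
\<close>

definition ancg_fun ::
  "'n::finite eps_algebra set \<Rightarrow> nat \<Rightarrow> ('n \<Rightarrow> 'n \<Rightarrow> 'n eps_algebra) \<Rightarrow> (nat \<Rightarrow> 'n eps_algebra)
    \<Rightarrow> 'n eps_algebra set set \<Rightarrow> real ^ 'n \<Rightarrow> complex" where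
  "ancg_fun F D c b a =
     (\<lambda>x\<in>ancg_set D b.
        THE z. \<exists>f\<in>F. a = ancg_pi F D c b (ancg_q F D c b f) \<and> z = comm_eval (classical f) x)"


section \<open>Elements of the limit as functions\<close>

lemma poly_mapping_sum_single:
  fixes p :: "'k \<Rightarrow>\<^sub>0 'b::comm_monoid_add"
  shows "p = (\<Sum>k\<in>Poly_Mapping.keys p. Poly_Mapping.single k (Poly_Mapping.lookup p k))"
proof (rule poly_mapping_eqI)
  fix k
  show "Poly_Mapping.lookup p k =
    Poly_Mapping.lookup (\<Sum>k\<in>Poly_Mapping.keys p. Poly_Mapping.single k (Poly_Mapping.lookup p k)) k"
    by (simp add: lookup_sum lookup_single when_def in_keys_iff)
qed

lemma additive_linear_extension:
  fixes g :: "'k \<Rightarrow> complex \<Rightarrow> 'b::ab_group_add"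
  assumes g: "\<And>k a a'. g k (a + a') = g k a + g k a'"
  shows "Modules.additive (\<lambda>p. \<Sum>k\<in>Poly_Mapping.keys p. g k (Poly_Mapping.lookup p k))"
proof
  fix p p' :: "'k \<Rightarrow>\<^sub>0 complex"
  have g0: "g k 0 = 0" for k
    using g[of k 0 0] by simp
  let ?K = "Poly_Mapping.keys p \<union> Poly_Mapping.keys p'"
  have ext: "(\<Sum>k\<in>Poly_Mapping.keys r. g k (Poly_Mapping.lookup r k)) =
      (\<Sum>k\<in>?K. g k (Poly_Mapping.lookup r k))" if "Poly_Mapping.keys r \<subseteq> ?K" for r
    by (rule sum.mono_neutral_left) (use that g0 in \<open>auto simp: in_keys_iff\<close>)
  show "(\<Sum>k\<in>Poly_Mapping.keys (p + p'). g k (Poly_Mapping.lookup (p + p') k)) =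
      (\<Sum>k\<in>Poly_Mapping.keys p. g k (Poly_Mapping.lookup p k)) +
      (\<Sum>k\<in>Poly_Mapping.keys p'. g k (Poly_Mapping.lookup p' k))"
    using ext[of p] ext[of p'] ext[OF Poly_Mapping.keys_add]
    by (simp add: lookup_add g sum.distrib)
qed

lemma additive_mult:
  fixes h :: "('k::monoid_add \<Rightarrow>\<^sub>0 complex) \<Rightarrow> 'b::ring_1"
  assumes "Modules.additive h"
    and single: "\<And>k l a a'. h (Poly_Mapping.single (k + l) (a * a')) =
        h (Poly_Mapping.single k a) * h (Poly_Mapping.single l a')"
  shows "h (p * p') = h p * h p'"
proof -
  interpret Modules.additive h by fact
  let ?s = "\<lambda>p k. Poly_Mapping.single k (Poly_Mapping.lookup p k)"
  have "h (p * p') = h ((\<Sum>k\<in>Poly_Mapping.keys p. ?s p k) * (\<Sum>l\<in>Poly_Mapping.keys p'. ?s p' l))"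
    using poly_mapping_sum_single[of p] poly_mapping_sum_single[of p'] by simp
  also have "\<dots> = (\<Sum>k\<in>Poly_Mapping.keys p. \<Sum>l\<in>Poly_Mapping.keys p'. h (?s p k) * h (?s p' l))"
    by (simp add: sum_product sum mult_single single)
  also have "\<dots> = h (\<Sum>k\<in>Poly_Mapping.keys p. ?s p k) * h (\<Sum>l\<in>Poly_Mapping.keys p'. ?s p' l)"
    by (simp add: sum_product sum)
  finally show ?thesis
    using poly_mapping_sum_single[of p] poly_mapping_sum_single[of p'] by simp
qed

lemma additive_comm_image: "Modules.additive comm_image"
  unfolding comm_image_def[abs_def]
  by (rule additive_linear_extension) (simp add: single_add distrib_right)

lemma comm_image_single:
  "comm_image (Poly_Mapping.single w a) =
     Poly_Mapping.single 0 a * prod_list (map comm_var (letters w))"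
  by (simp add: comm_image_def)

lemma comm_image_mult: "comm_image (p * p') = comm_image p * comm_image p'"
proof (rule additive_mult[OF additive_comm_image])
  fix k l :: "'a nc_word" and a a' :: complex
  have "Poly_Mapping.single (0 :: 'a \<Rightarrow>\<^sub>0 nat) (a * a') =
      Poly_Mapping.single 0 a * Poly_Mapping.single 0 a'"
    by (simp add: mult_single)
  then show "comm_image (Poly_Mapping.single (k + l) (a * a')) =
      comm_image (Poly_Mapping.single k a) * comm_image (Poly_Mapping.single l a')"
    by (simp add: comm_image_single plus_nc_word_def mult_ac)
qed

lemma additive_comm_eval: "Modules.additive (\<lambda>p. comm_eval p x)"
  unfolding comm_eval_def[abs_def]
  by (rule additive_linear_extension) (simp add: distrib_right)

lemma comm_eval_single:
  "comm_eval (Poly_Mapping.single m a) x =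
     a * (\<Prod>i\<in>UNIV. complex_of_real (x $ i) ^ Poly_Mapping.lookup m i)"
  by (simp add: comm_eval_def)

lemma comm_eval_mult: "comm_eval (p * p') x = comm_eval p x * comm_eval p' x"
  by (rule additive_mult[OF additive_comm_eval])
    (simp add: comm_eval_single lookup_add power_add prod.distrib mult_ac)

lemma monomial_word:
  "\<exists>w. prod_list (map comm_var (letters w)) = Poly_Mapping.single m 1"
proof -
  let ?P = "\<lambda>m. \<exists>w. prod_list (map comm_var (letters w)) = Poly_Mapping.single m 1"
  have zero: "?P 0"
    by (rule exI[of _ "NC_Word []"]) simp
  have add: "?P (m + m')" if "?P m" "?P m'" for m m' :: "'a \<Rightarrow>\<^sub>0 nat"
  proof -
    from that obtain w w' where
      "prod_list (map comm_var (letters w)) = Poly_Mapping.single m 1"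
      "prod_list (map comm_var (letters w')) = Poly_Mapping.single m' 1" by blast
    then show ?thesis
      by (intro exI[of _ "w + w'"]) (simp add: plus_nc_word_def mult_single)
  qed
  have single: "?P (Poly_Mapping.single i k)" for i :: 'a and k
  proof (induction k)
    case 0
    show ?case using zero by simp
  next
    case (Suc k)
    have "?P (Poly_Mapping.single i 1)"
      by (rule exI[of _ "NC_Word [i]"]) (simp add: comm_var_def)
    from add[OF this Suc] show ?case
      by (simp add: single_add[symmetric])
  qed
  have "?P (\<Sum>k\<in>K. Poly_Mapping.single k (Poly_Mapping.lookup m k))" for K
  proof (induction K rule: infinite_finite_induct)
    case (insert k K)
    from add[OF single insert.IH] show ?case
      using insert.hyps by simp
  qed (use zero in simp_all)
  then show ?thesis
    using poly_mapping_sum_single[of m] by metis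
qed

lemma comm_image_surj: "\<exists>r. comm_image r = p"
proof -
  interpret Modules.additive comm_image by (rule additive_comm_image)
  obtain w :: "('a \<Rightarrow>\<^sub>0 nat) \<Rightarrow> 'a nc_word" where
    w: "\<And>m. prod_list (map comm_var (letters (w m))) = Poly_Mapping.single m 1"
    using monomial_word by metis
  have "comm_image (\<Sum>m\<in>Poly_Mapping.keys p. Poly_Mapping.single (w m) (Poly_Mapping.lookup p m)) =
      (\<Sum>m\<in>Poly_Mapping.keys p. Poly_Mapping.single m (Poly_Mapping.lookup p m))"
    by (simp add: sum comm_image_single w mult_single)
  then show ?thesis
    using poly_mapping_sum_single[of p] by metis
qed

lemma classical_eval_hom:
  "comm_eval (classical (f + g)) x = comm_eval (classical f) x + comm_eval (classical g) x"
  "comm_eval (classical (f - g)) x = comm_eval (classical f) x - comm_eval (classical g) x"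
  "comm_eval (classical (f * g)) x = comm_eval (classical f) x * comm_eval (classical g) x"
  "comm_eval (classical 0) x = 0"
  "comm_eval (classical (- f)) x = - comm_eval (classical f) x"
  "comm_eval (classical eps) x = 0"
proof -
  interpret i: Modules.additive comm_image by (rule additive_comm_image)
  interpret e: Modules.additive "\<lambda>p. comm_eval p x" by (rule additive_comm_eval)
  show
    "comm_eval (classical (f + g)) x = comm_eval (classical f) x + comm_eval (classical g) x"
    "comm_eval (classical (f - g)) x = comm_eval (classical f) x - comm_eval (classical g) x"
    "comm_eval (classical (f * g)) x = comm_eval (classical f) x * comm_eval (classical g) x"
    "comm_eval (classical 0) x = 0"
    "comm_eval (classical (- f)) x = - comm_eval (classical f) x"
    "comm_eval (classical eps) x = 0"
    by (simp_all add: classical_def eps_def i.add i.diff i.minus i.zero e.add e.diff e.minus e.zero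
        comm_image_mult comm_eval_mult)
qed

lemma eps_polynomials_mult:
  assumes "f \<in> eps_polynomials" "g \<in> eps_polynomials"
  shows "f * g \<in> eps_polynomials"
proof -
  let ?K = "\<lambda>f. {k. fps_nth f k \<noteq> 0}"
  have "?K (f * g) \<subseteq> (\<lambda>(i, j). i + j) ` (?K f \<times> ?K g)"
  proof
    fix k assume "k \<in> ?K (f * g)"
    then have "(\<Sum>i=0..k. fps_nth f i * fps_nth g (k - i)) \<noteq> 0"
      by (simp add: fps_mult_nth)
    then obtain i where "i \<in> {0..k}" "fps_nth f i * fps_nth g (k - i) \<noteq> 0"
      by (meson sum.neutral)
    then show "k \<in> (\<lambda>(i, j). i + j) ` (?K f \<times> ?K g)"
      by (intro image_eqI[of _ _ "(i, k - i)"]) auto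
  qed
  then show ?thesis
    using assms unfolding eps_polynomials_def
    by (auto intro: finite_subset)
qed

lemma eps_polynomials_diff:
  assumes "f \<in> eps_polynomials" "g \<in> eps_polynomials"
  shows "f - g \<in> eps_polynomials"
proof -
  have "{k. fps_nth (f - g) k \<noteq> 0} \<subseteq> {k. fps_nth f k \<noteq> 0} \<union> {k. fps_nth g k \<noteq> 0}"
    by auto
  then show ?thesis
    using assms unfolding eps_polynomials_def by (auto intro: finite_subset)
qed

lemma fps_const_eps_polynomials: "fps_const a \<in> eps_polynomials"
  unfolding eps_polynomials_def by (auto intro: finite_subset[of _ "{0}"] split: if_splits)

lemma eps_eps_polynomials: "eps \<in> eps_polynomials"
  unfolding eps_polynomials_def eps_def by (auto intro: finite_subset[of _ "{1}"] split: if_splits)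

lemma eps_central: "eps * f = f * eps"
  by (simp add: eps_def fps_mult_fps_X_commute)

context ancg
begin

lemma F_closed:
  "f \<in> F \<Longrightarrow> g \<in> F \<Longrightarrow> f * g \<in> F"
  "f \<in> F \<Longrightarrow> g \<in> F \<Longrightarrow> f - g \<in> F"
  "fps_const a \<in> F" "0 \<in> F" "1 \<in> F" "eps \<in> F" "gen i \<in> F" "scal z \<in> F"
  using poly_or_series fps_const_eps_polynomials[of 0] fps_const_eps_polynomials[of 1]
  by (auto simp: eps_polynomials_mult eps_polynomials_diff fps_const_eps_polynomials
      eps_eps_polynomials gen_def scal_def)

lemma F_uminus: "f \<in> F \<Longrightarrow> - f \<in> F"
  using F_closed(2)[of 0 f] F_closed(4) by simp

lemma F_add: "f \<in> F \<Longrightarrow> g \<in> F \<Longrightarrow> f + g \<in> F"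
  using F_closed(2)[of f "- g"] F_uminus by simp

lemma eps_ring_simps [simp]:
  "carrier (eps_ring F) = F" "f \<otimes>\<^bsub>eps_ring F\<^esub> g = f * g" "f \<oplus>\<^bsub>eps_ring F\<^esub> g = f + g"
  "\<one>\<^bsub>eps_ring F\<^esub> = 1" "\<zero>\<^bsub>eps_ring F\<^esub> = 0"
  by (simp_all add: eps_ring_def)

lemma ring_eps_ring: "ring (eps_ring F)"
proof (rule ringI)
  show "abelian_group (eps_ring F)"
  proof (rule abelian_groupI)
    fix f assume "f \<in> carrier (eps_ring F)"
    then show "\<exists>g\<in>carrier (eps_ring F). g \<oplus>\<^bsub>eps_ring F\<^esub> f = \<zero>\<^bsub>eps_ring F\<^esub>"
      by (intro bexI[of _ "- f"]) (simp_all add: F_uminus)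
  qed (simp_all add: F_closed F_add add_ac)
  show "Group.monoid (eps_ring F)"
    by (rule monoidI) (simp_all add: F_closed mult.assoc)
qed (simp_all add: distrib_left distrib_right)

lemma eps_ring_minus:
  assumes "f \<in> F" "g \<in> F"
  shows "f \<ominus>\<^bsub>eps_ring F\<^esub> g = f - g"
proof -
  interpret R: ring "eps_ring F" by (rule ring_eps_ring)
  have "\<ominus>\<^bsub>eps_ring F\<^esub> g = - g"
    using R.minus_equality[of "- g" g] assms by (simp add: F_uminus)
  then show ?thesis
    by (simp add: a_minus_def)
qed

lemma c_in: "c i j \<in> F"
  using commutators by (metis F_closed(1,2,6-8))

lemma relations_in: "{c i j | i j. True} \<union> b ` {1..CARD('n) - D} \<subseteq> F"
  using c_in b_in by auto

lemma ideal_ancg_ideal: "ideal (ancg_ideal F D c b) (eps_ring F)"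
  unfolding ancg_ideal_def
  by (rule ring.genideal_ideal[OF ring_eps_ring]) (use relations_in in simp)

lemma ring_algebra: "ring (ancg_algebra F D c b)"
  unfolding ancg_algebra_def by (rule ideal.quotient_is_ring[OF ideal_ancg_ideal])

lemma q_hom: "ancg_q F D c b \<in> ring_hom (eps_ring F) (ancg_algebra F D c b)"
  using ideal.rcos_ring_hom[OF ideal_ancg_ideal] unfolding ancg_algebra_def ancg_q_def .

lemma carrier_algebra: "carrier (ancg_algebra F D c b) = ancg_q F D c b ` F"
  unfolding ancg_algebra_def ancg_q_def FactRing_def A_RCOSETS_def' by auto

lemma ideal_eps_multiples: "ideal (ancg_eps_multiples F D c b) (ancg_algebra F D c b)"
proof -
  let ?A = "ancg_algebra F D c b" and ?e = "ancg_q F D c b eps"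
  interpret A: ring ?A by (rule ring_algebra)
  have e: "?e \<in> carrier ?A"
    by (simp add: carrier_algebra F_closed)
  have central: "?e \<otimes>\<^bsub>?A\<^esub> u = u \<otimes>\<^bsub>?A\<^esub> ?e" if "u \<in> carrier ?A" for u
  proof -
    from that obtain f where f: "f \<in> F" "u = ancg_q F D c b f"
      by (auto simp: carrier_algebra)
    then show ?thesis
      using ring_hom_mult[OF q_hom, of eps f] ring_hom_mult[OF q_hom, of f eps]
      by (simp add: F_closed eps_central)
  qed
  show ?thesis
  proof (rule idealI[OF ring_algebra])
    show "subgroup (ancg_eps_multiples F D c b) (add_monoid ?A)"
    proof (rule A.add.subgroupI)
      show "ancg_eps_multiples F D c b \<subseteq> carrier ?A"
        using e by (auto simp: ancg_eps_multiples_def)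
      show "ancg_eps_multiples F D c b \<noteq> {}"
        by (auto simp: ancg_eps_multiples_def)
    next
      fix u assume "u \<in> ancg_eps_multiples F D c b"
      then obtain v where "v \<in> carrier ?A" "u = ?e \<otimes>\<^bsub>?A\<^esub> v"
        by (auto simp: ancg_eps_multiples_def)
      then show "\<ominus>\<^bsub>?A\<^esub> u \<in> ancg_eps_multiples F D c b"
        using e A.r_minus[of ?e v] unfolding ancg_eps_multiples_def by (auto intro!: exI[of _ "\<ominus>\<^bsub>?A\<^esub> v"])
    next
      fix u u' assume "u \<in> ancg_eps_multiples F D c b" "u' \<in> ancg_eps_multiples F D c b"
      then obtain v v' where "v \<in> carrier ?A" "u = ?e \<otimes>\<^bsub>?A\<^esub> v" "v' \<in> carrier ?A" "u' = ?e \<otimes>\<^bsub>?A\<^esub> v'"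
        by (auto simp: ancg_eps_multiples_def)
      then show "u \<oplus>\<^bsub>?A\<^esub> u' \<in> ancg_eps_multiples F D c b"
        using e A.r_distr[of v v' ?e] unfolding ancg_eps_multiples_def
        by (auto intro!: exI[of _ "v \<oplus>\<^bsub>?A\<^esub> v'"])
    qed
  next
    fix u w assume u: "u \<in> ancg_eps_multiples F D c b" and w: "w \<in> carrier ?A"
    then obtain v where v: "v \<in> carrier ?A" "u = ?e \<otimes>\<^bsub>?A\<^esub> v"
      by (auto simp: ancg_eps_multiples_def)
    have "w \<otimes>\<^bsub>?A\<^esub> u = ?e \<otimes>\<^bsub>?A\<^esub> (w \<otimes>\<^bsub>?A\<^esub> v)"
      using e w v central[OF w] by (simp add: A.m_assoc[symmetric])
    then show "w \<otimes>\<^bsub>?A\<^esub> u \<in> ancg_eps_multiples F D c b"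
      using w v unfolding ancg_eps_multiples_def by auto
    have "u \<otimes>\<^bsub>?A\<^esub> w = ?e \<otimes>\<^bsub>?A\<^esub> (v \<otimes>\<^bsub>?A\<^esub> w)"
      using e w v by (simp add: A.m_assoc)
    then show "u \<otimes>\<^bsub>?A\<^esub> w \<in> ancg_eps_multiples F D c b"
      using w v unfolding ancg_eps_multiples_def by auto
  qed
qed

lemma pi_hom: "ancg_pi F D c b \<in> ring_hom (ancg_algebra F D c b) (ancg_limit F D c b)"
  using ideal.rcos_ring_hom[OF ideal_eps_multiples] unfolding ancg_limit_def ancg_pi_def .

lemma carrier_limit:
  "carrier (ancg_limit F D c b) = (\<lambda>f. ancg_pi F D c b (ancg_q F D c b f)) ` F"
  unfolding ancg_limit_def ancg_pi_def FactRing_def A_RCOSETS_def' by (auto simp: carrier_algebra)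

lemma ancg_ideal_vanishes:
  assumes x: "x \<in> ancg_set D b" and f: "f \<in> ancg_ideal F D c b"
  shows "comm_eval (classical f) x = 0"
proof -
  interpret R: ring "eps_ring F" by (rule ring_eps_ring)
  let ?K = "{f \<in> F. comm_eval (classical f) x = 0}"
  have minus: "\<ominus>\<^bsub>eps_ring F\<^esub> g = - g" if "g \<in> F" for g
    using R.minus_equality[of "- g" g] that by (simp add: F_uminus)
  have "ideal ?K (eps_ring F)"
  proof (rule idealI[OF ring_eps_ring])
    show "subgroup ?K (add_monoid (eps_ring F))"
    proof (rule R.add.subgroupI)
      show "?K \<noteq> {}"
        using F_closed(4) classical_eval_hom(4)[of x] by blast
    next
      fix g assume "g \<in> ?K"
      then show "\<ominus>\<^bsub>eps_ring F\<^esub> g \<in> ?K"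
        by (simp add: minus F_uminus classical_eval_hom)
    qed (auto simp: F_add classical_eval_hom)
  qed (auto simp: F_closed classical_eval_hom)
  moreover have "{c i j | i j. True} \<union> b ` {1..CARD('n) - D} \<subseteq> ?K"
  proof -
    obtain c' where "\<And>i j. c i j = gen i * gen j - gen j * gen i - scal \<i> * eps * c' i j"
      using commutators by blast
    then have "comm_eval (classical (c i j)) x = 0" for i j
      by (simp add: classical_eval_hom mult.commute)
    moreover have "comm_eval (classical (b s)) x = 0" if "s \<in> {1..CARD('n) - D}" for s
      using x that by (simp add: ancg_set_def)
    ultimately show ?thesis
      using c_in b_in by auto
  qed
  ultimately have "ancg_ideal F D c b \<subseteq> ?K"
    unfolding ancg_ideal_def by (rule R.genideal_minimal)
  then show ?thesis using f by auto
qed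

lemma pi_q_eq_imp_eval_eq:
  assumes f: "f \<in> F" and g: "g \<in> F"
    and eq: "ancg_pi F D c b (ancg_q F D c b f) = ancg_pi F D c b (ancg_q F D c b g)"
    and x: "x \<in> ancg_set D b"
  shows "comm_eval (classical f) x = comm_eval (classical g) x"
proof -
  let ?A = "ancg_algebra F D c b" and ?q = "ancg_q F D c b"
  interpret R: ring "eps_ring F" by (rule ring_eps_ring)
  interpret A: ring ?A by (rule ring_algebra)
  interpret q: ring_hom_ring "eps_ring F" ?A ?q
    by (rule ring_hom_ringI2[OF ring_eps_ring ring_algebra q_hom])
  have "?q f \<ominus>\<^bsub>?A\<^esub> ?q g \<in> ancg_eps_multiples F D c b"
    using A.quotient_eq_iff_same_a_r_cos[OF ideal_eps_multiples, of "?q f" "?q g"] eq f g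
    by (simp add: carrier_algebra ancg_pi_def)
  then obtain h where h: "h \<in> F" "?q f \<ominus>\<^bsub>?A\<^esub> ?q g = ?q eps \<otimes>\<^bsub>?A\<^esub> ?q h"
    by (auto simp: ancg_eps_multiples_def carrier_algebra)
  have "?q f \<ominus>\<^bsub>?A\<^esub> ?q g = ?q (f \<ominus>\<^bsub>eps_ring F\<^esub> g)"
    using f g q.hom_add[of f "\<ominus>\<^bsub>eps_ring F\<^esub> g"] q.hom_a_inv[of g] R.a_inv_closed[of g]
    unfolding a_minus_def by (simp del: eps_ring_simps(3) q.hom_add)
  then have "?q (f - g) = ?q (eps * h)"
    using h q.hom_mult[of eps h] f g by (simp add: eps_ring_minus F_closed)
  then have "(f - g) \<ominus>\<^bsub>eps_ring F\<^esub> (eps * h) \<in> ancg_ideal F D c b"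
    using R.quotient_eq_iff_same_a_r_cos[OF ideal_ancg_ideal, of "f - g" "eps * h"] f g h
    by (simp add: ancg_q_def F_closed)
  then have "f - g - eps * h \<in> ancg_ideal F D c b"
    using f g h by (simp add: eps_ring_minus F_closed)
  from ancg_ideal_vanishes[OF x this] show ?thesis
    by (simp add: classical_eval_hom)
qed

lemma ancg_fun_pi_q:
  assumes "f \<in> F"
  shows "ancg_fun F D c b (ancg_pi F D c b (ancg_q F D c b f)) =
    restrict (comm_eval (classical f)) (ancg_set D b)"
proof
  fix x
  show "ancg_fun F D c b (ancg_pi F D c b (ancg_q F D c b f)) x =
    restrict (comm_eval (classical f)) (ancg_set D b) x"
  proof (cases "x \<in> ancg_set D b")
    case True
    have "(THE z. \<exists>g\<in>F. ancg_pi F D c b (ancg_q F D c b f) = ancg_pi F D c b (ancg_q F D c b g) \<and>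
        z = comm_eval (classical g) x) = comm_eval (classical f) x"
      using assms True by (intro the_equality) (auto intro: pi_q_eq_imp_eval_eq)
    then show ?thesis
      using True by (simp add: ancg_fun_def)
  qed (simp add: ancg_fun_def)
qed

lemma ancg_fun_range:
  "ancg_fun F D c b ` carrier (ancg_limit F D c b) = {restrict (comm_eval p) (ancg_set D b) | p. True}"
proof -
  have "\<exists>f\<in>F. classical f = p" for p
  proof -
    obtain r where "comm_image r = p" using comm_image_surj by blast
    then show ?thesis
      by (intro bexI[of _ "fps_const r"]) (simp_all add: classical_def F_closed)
  qed
  then show ?thesis
    by (auto simp: carrier_limit image_image ancg_fun_pi_q) (metis ancg_fun_pi_q image_eqI)
qed

end

end

theory Submission
  imports Defs
begin

text \<open>\<open>ancg_fun_range\<close> turns the image of the limit algebra into the restrictions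
  to M of complex polynomials in the coordinates; these are continuous, so they lie in C(M). Density
  is Weierstrass approximation on a compact subset of Euclidean space. The library proves it for the
  coordinate-free \<open>polynomial_function\<close>, so the work is to write each such function as
  some \<open>comm_eval p\<close> (\<open>polynomial_function_comm_eval\<close>) and to pass from
  pointwise bounds to the uniform distance (\<open>comm_eval_approximation\<close>).\<close>

text \<open>
  The functions given by elements of the commutative limit are exactly the restrictions of complex
  polynomials, so the claim is the Stone-Weierstrass theorem.
\<close>

lemma continuous_on_comm_eval: "continuous_on S (comm_eval p)"
  unfolding comm_eval_def[abs_def] by (intro continuous_intros)

lemma comm_eval_add: "comm_eval (p + p') x = comm_eval p x + comm_eval p' x"
  using additive_comm_eval[of x] by (rule Modules.additive.add)

lemma comm_eval_sum: "comm_eval (sum f A) x = (\<Sum>a\<in>A. comm_eval (f a) x)"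
  using additive_comm_eval[of x] by (rule Modules.additive.sum)

lemma comm_eval_const: "comm_eval (Poly_Mapping.single 0 a) x = a"
  by (simp add: comm_eval_single)

lemma comm_eval_var: "comm_eval (comm_var i) x = complex_of_real (x $ i)"
proof -
  have "(\<Prod>j\<in>UNIV. complex_of_real (x $ j) ^ Poly_Mapping.lookup (Poly_Mapping.single i 1) j)
      = (\<Prod>j\<in>UNIV. if j = i then complex_of_real (x $ j) else 1)"
    by (intro prod.cong) (auto simp: lookup_single when_def)
  then show ?thesis
    by (simp add: comm_var_def comm_eval_single)
qed

text \<open>Induction over the generation of real polynomial functions from bounded linear
  functionals and constants by sums and products. A functional is a combination of coordinates, with
  its values on the standard basis as coefficients.\<close>

lemma real_polynomial_function_comm_eval:
  fixes h :: "real ^ 'n::finite \<Rightarrow> real"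
  assumes "real_polynomial_function h"
  shows "\<exists>p. \<forall>x. comm_eval p x = complex_of_real (h x)"
  using assms
proof (induction rule: real_polynomial_function.induct)
  case (linear f)
  then interpret bounded_linear f .
  have expand: "(\<Sum>i\<in>UNIV. x $ i * f (axis i 1)) = f x" for x
  proof -
    have "f x = f (\<Sum>i\<in>UNIV. x $ i *\<^sub>R axis i 1)"
      using basis_expansion[of x] by (simp add: scalar_mult_eq_scaleR)
    then show ?thesis
      by (simp add: sum scaleR)
  qed
  then show ?case
    by (intro exI[of _ "\<Sum>i\<in>UNIV. comm_var i * Poly_Mapping.single 0 (complex_of_real (f (axis i 1)))"])
      (simp add: comm_eval_sum comm_eval_mult comm_eval_var comm_eval_const expand
        flip: of_real_mult of_real_sum)
next
  case (const a)
  show ?case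
    by (rule exI[of _ "Poly_Mapping.single 0 (complex_of_real a)"]) (simp add: comm_eval_const)
next
  case (add f g)
  then obtain p p' where "\<forall>x. comm_eval p x = complex_of_real (f x)"
    "\<forall>x. comm_eval p' x = complex_of_real (g x)" by blast
  then show ?case
    by (intro exI[of _ "p + p'"]) (simp add: comm_eval_add)
next
  case (mult f g)
  then obtain p p' where "\<forall>x. comm_eval p x = complex_of_real (f x)"
    "\<forall>x. comm_eval p' x = complex_of_real (g x)" by blast
  then show ?case
    by (intro exI[of _ "p * p'"]) (simp add: comm_eval_mult)
qed

text \<open>A vector-valued function counts as polynomial when all its compositions with bounded
  linear functionals do. Applying this to \<open>Re\<close> and \<open>Im\<close> gives two
  polynomials, reassembled with the coefficient \<i>.\<close>

lemma polynomial_function_comm_eval: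
  fixes g :: "real ^ 'n::finite \<Rightarrow> complex"
  assumes "polynomial_function g"
  shows "\<exists>p. comm_eval p = g"
proof -
  have "real_polynomial_function (Re \<circ> g)" "real_polynomial_function (Im \<circ> g)"
    using assms bounded_linear_Re bounded_linear_Im unfolding polynomial_function_def by blast+
  then obtain p p' where p: "\<forall>x. comm_eval p x = complex_of_real (Re (g x))"
    "\<forall>x. comm_eval p' x = complex_of_real (Im (g x))"
    using real_polynomial_function_comm_eval by (metis comp_apply)
  have "comm_eval (p + Poly_Mapping.single 0 \<i> * p') = g"
    by (rule ext) (simp add: comm_eval_add comm_eval_mult comm_eval_const p complex_eq[symmetric])
  then show ?thesis ..
qed

lemma comm_eval_in_complex_functions:
  assumes "compact M"
  shows "restrict (comm_eval p) M \<in> mspace (complex_functions M)"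
  using continuous_on_comm_eval[of M p]
  by (simp add: mspace_complex_functions[OF assms] cong: continuous_on_cong)

lemma comm_eval_approximation:
  assumes M: "compact M" and f: "f \<in> mspace (complex_functions M)" and e: "0 < e"
  shows "\<exists>p. mdist (complex_functions M) f (restrict (comm_eval p) M) < e"
proof (cases "M = {}")
  \<comment> \<open>The supremum formula for the distance needs a nonempty M. Over the empty set,
    extensionality leaves a single function.\<close>
  case True
  then have "f = restrict (comm_eval 0) M"
    using f mspace_complex_functions[OF M] by auto
  then show ?thesis
    using f e by (metis mdist_zero)
next
  case False
  have "continuous_on M f"
    using f mspace_complex_functions[OF M] by blast
  \<comment> \<open>Strict pointwise bounds give only a weak bound on the supremum; halving e
    restores strictness.\<close>
  then obtain g where g: "polynomial_function g" "\<And>x. x \<in> M \<Longrightarrow> norm (f x - g x) < e / 2"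
    using Stone_Weierstrass_polynomial_function[OF M, of f "e / 2"] e by auto
  obtain p where p: "comm_eval p = g"
    using polynomial_function_comm_eval[OF g(1)] by blast
  have "mdist (complex_functions M) f (restrict (comm_eval p) M)
      = (SUP x\<in>M. norm (f x - restrict (comm_eval p) M x))"
    by (rule mdist_complex_functions[OF f comm_eval_in_complex_functions[OF M] False])
  also have "\<dots> \<le> e / 2"
    using False g(2) p by (intro cSUP_least) (auto simp: less_imp_le)
  finally show ?thesis
    using e by (intro exI[of _ p]) simp
qed

theorem lemma1:
  fixes F :: "'n::finite eps_algebra set"
    and D :: nat
    and c :: "'n \<Rightarrow> 'n \<Rightarrow> 'n eps_algebra"
    and b :: "nat \<Rightarrow> 'n eps_algebra"
  assumes "ancg F D c b"
    and "compact (ancg_set D b)"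
  shows "ancg_fun F D c b ` carrier (ancg_limit F D c b)
           \<subseteq> mspace (complex_functions (ancg_set D b))
       \<and> mtopology_of (complex_functions (ancg_set D b))
             closure_of (ancg_fun F D c b ` carrier (ancg_limit F D c b))
           = mspace (complex_functions (ancg_set D b))"
proof -
  let ?X = "complex_functions (ancg_set D b)"
  let ?S = "{restrict (comm_eval p) (ancg_set D b) | p. True}"
  interpret X: Metric_space "mspace ?X" "mdist ?X"
    by simp
  have sub: "?S \<subseteq> mspace ?X"
    using comm_eval_in_complex_functions[OF assms(2)] by blast
  \<comment> \<open>This inclusion is the density; the reverse one holds for any closure in the
    space.\<close>
  have "mspace ?X \<subseteq> X.mtopology closure_of ?S"
  proof
    fix f assume f: "f \<in> mspace ?X"
    have "\<exists>g\<in>?S. g \<in> X.mball f e" if "0 < e" for e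
      using comm_eval_approximation[OF assms(2) f that] f sub
      unfolding X.in_mball by blast
    then show "f \<in> X.mtopology closure_of ?S"
      using f unfolding X.metric_closure_of by blast
  qed
  then have "mtopology_of ?X closure_of ?S = mspace ?X"
    using closure_of_subset_topspace[of X.mtopology ?S] by (auto simp: mtopology_of_def)
  then show ?thesis
    using sub by (simp add: ancg.ancg_fun_range[OF assms(1)])
qed

end
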